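(* Let $X$ be a separable infinite-dimensional complex Banach space. Then there exists a recurrent bounded operator $T$ on $X$ such that $\mathrm{Hr}(T)=\emptyset$ and the set of $q\in\mathrm{St}(T)$ such that $\overline{\mathfrak{L}(\omega)}$ has codimension $1$ in $X$ for every $\omega\in\mathfrak{C}$ with $q\in\mathfrak{L}(\omega)$ is dense in $X$.
   Context: For a bounded operator $T$ on $X$: $x$ is recurrent if $T^{\omega_n}x\to x$ for some strictly increasing sequence $(\omega_n)$ of positive integers; $\mathrm{Rec}(T)$ is the set of recurrent vectors and $T$ is recurrent if $\mathrm{Rec}(T)$ is dense. $\mathfrak{C}$ is the set of strictly increasing sequences $\omega$ of positive integers such that $T^{\omega_n}x\to x$ for some $x\ne 0$; $\mathfrak{L}(\omega)=\{x:T^{\omega_n}x\to x\}$. A sequence $\omega\in\mathfrak{C}$ is stationary if $\overline{\mathfrak{L}(\omega)}=\overline{\mathfrak{L}(\mu)}$ for every subsequence $\mu$ of $\omega$. $\mathrm{St}(T)$ is the set of $x\in\mathrm{Rec}(T)$ such that every $\omega\in\mathfrak{C}$ with $x\in\mathfrak{L}(\omega)$ is stationary. $\mathrm{Hr}(T)$ is the set of $x\in\mathrm{Rec}(T)$ such that $\mathfrak{L}(\omega)$ is dense in $X$ for every $\omega\in\mathfrak{C}$ with $x\in\mathfrak{L}(\omega)$. *)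

theory Defs
  imports "HOL-Analysis.Analysis"
begin

definition complex_banach_scale :: "(complex \<Rightarrow> 'a::banach \<Rightarrow> 'a) \<Rightarrow> bool" where
  "complex_banach_scale sc \<longleftrightarrow>
     vector_space sc \<and>
     (\<forall>r x. sc (complex_of_real r) x = r *\<^sub>R x) \<and>
     (\<forall>c x. norm (sc c x) = cmod c * norm x)"

definition infinite_dim_complex :: "(complex \<Rightarrow> 'a::ab_group_add \<Rightarrow> 'a) \<Rightarrow> bool" where
  "infinite_dim_complex sc \<longleftrightarrow> \<not> (\<exists>B. finite B \<and> module.span sc B = UNIV)"

definition bounded_complex_operator ::
    "(complex \<Rightarrow> 'a::real_normed_vector \<Rightarrow> 'a) \<Rightarrow> ('a \<Rightarrow> 'a) \<Rightarrow> bool" where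
  "bounded_complex_operator sc T \<longleftrightarrow> bounded_linear T \<and> Vector_Spaces.linear sc sc T"

definition Lset :: "('a::topological_space \<Rightarrow> 'a) \<Rightarrow> (nat \<Rightarrow> nat) \<Rightarrow> 'a set" where
  "Lset T \<omega> = {x. (\<lambda>n. (T ^^ \<omega> n) x) \<longlonglongrightarrow> x}"

definition Rec :: "('a::topological_space \<Rightarrow> 'a) \<Rightarrow> 'a set" where
  "Rec T = {x. \<exists>\<omega>. strict_mono \<omega> \<and> (\<forall>n. 0 < \<omega> n) \<and> x \<in> Lset T \<omega>}"

definition recurrent :: "('a::topological_space \<Rightarrow> 'a) \<Rightarrow> bool" where
  "recurrent T \<longleftrightarrow> closure (Rec T) = UNIV"

definition Cseq :: "('a::{topological_space,zero} \<Rightarrow> 'a) \<Rightarrow> (nat \<Rightarrow> nat) set" where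
  "Cseq T = {\<omega>. strict_mono \<omega> \<and> (\<forall>n. 0 < \<omega> n) \<and> (\<exists>x. x \<noteq> 0 \<and> x \<in> Lset T \<omega>)}"

definition stationary :: "('a::{topological_space,zero} \<Rightarrow> 'a) \<Rightarrow> (nat \<Rightarrow> nat) \<Rightarrow> bool" where
  "stationary T \<omega> \<longleftrightarrow> \<omega> \<in> Cseq T \<and>
     (\<forall>r. strict_mono r \<longrightarrow> closure (Lset T \<omega>) = closure (Lset T (\<omega> \<circ> r)))"

definition St :: "('a::{topological_space,zero} \<Rightarrow> 'a) \<Rightarrow> 'a set" where
  "St T = {x \<in> Rec T. \<forall>\<omega>\<in>Cseq T. x \<in> Lset T \<omega> \<longrightarrow> stationary T \<omega>}"

definition Hr :: "('a::{topological_space,zero} \<Rightarrow> 'a) \<Rightarrow> 'a set" where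
  "Hr T = {x \<in> Rec T. \<forall>\<omega>\<in>Cseq T. x \<in> Lset T \<omega> \<longrightarrow> closure (Lset T \<omega>) = UNIV}"

definition codim_one :: "(complex \<Rightarrow> 'a::ab_group_add \<Rightarrow> 'a) \<Rightarrow> 'a set \<Rightarrow> bool" where
  "codim_one sc M \<longleftrightarrow> module.subspace sc M \<and> M \<noteq> UNIV \<and>
     (\<exists>v. \<forall>x. \<exists>c. x - sc c v \<in> M)"

end

theory Submission
  imports Defs
begin

text \<open>Take a biorthogonal system \<open>(e k, \<phi> k)\<close> with dense span and put \<open>b k = e (k + 2)\<close>. The operator is
  diagonal with respect to the vectors \<open>b k\<close> and the functionals
  \<open>h k = \<phi> (k + 2) + c k * (\<phi> 1 - d k * \<phi> 0)\<close>, with eigenvalue \<open>lam k\<close> a root of unity of order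
  \<open>q (Suc k)\<close>; hence \<open>T^N x - x\<close> is the sum of the vectors \<open>(lam k ^ N - 1) * h k x * b k\<close>. Here \<open>q k\<close>
  divides \<open>q (Suc k)\<close> and grows very fast, \<open>c k\<close> is comparable to \<open>q (Suc k) / q k\<close>, and \<open>d\<close> takes each
  value of a countable dense set infinitely often.

  A time \<open>N\<close> with \<open>q k \<le> 4 * N < q (Suc k)\<close> can be a good return time for \<open>y\<close> only if
  \<open>\<phi> 1 y - d k * \<phi> 0 y\<close> is small, so along any sequence the returning vectors all lie in one hyperplane
  \<open>a * \<phi> 1 = c * \<phi> 0\<close>. Conversely, if \<open>\<phi> 1 x = d K * \<phi> 0 x\<close> for a finite combination \<open>x\<close> of the \<open>e k\<close>,
  then \<open>h K x = 0\<close> for large such \<open>K\<close> and \<open>q K\<close> is a good return time for \<open>x\<close>. If moreover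
  \<open>\<phi> 0 x \<noteq> 0\<close>, then every sequence along which \<open>x\<close> returns is eventually divisible by each \<open>q k\<close>, so all
  \<open>b k\<close> return along it and the closure of the returning vectors is the whole hyperplane through \<open>x\<close>.\<close>

section \<open>Norming functionals\<close>

definition sublinear :: "('a::real_vector \<Rightarrow> real) \<Rightarrow> bool" where
  "sublinear p \<longleftrightarrow> (\<forall>x y. p (x + y) \<le> p x + p y) \<and> (\<forall>t x. 0 < t \<longrightarrow> p (t *\<^sub>R x) = t * p x)"

lemma sublinearI:
  assumes "\<And>x y. p (x + y) \<le> p x + p y"
    and "\<And>t x. 0 < t \<Longrightarrow> p (t *\<^sub>R x) \<le> t * p x"
  shows "sublinear p"
proof -
  have "p (t *\<^sub>R x) = t * p x" if "0 < t" for t x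
  proof (rule antisym)
    show "p (t *\<^sub>R x) \<le> t * p x" using assms(2) that .
    have "p x \<le> inverse t * p (t *\<^sub>R x)"
      using assms(2)[of "inverse t" "t *\<^sub>R x"] that by simp
    then show "t * p x \<le> p (t *\<^sub>R x)"
      using that by (simp add: field_simps)
  qed
  with assms(1) show ?thesis unfolding sublinear_def by blast
qed

lemma sublinear_add: "sublinear p \<Longrightarrow> p (x + y) \<le> p x + p y"
  and sublinear_scaleR: "sublinear p \<Longrightarrow> 0 < t \<Longrightarrow> p (t *\<^sub>R x) = t * p x"
  unfolding sublinear_def by blast+

lemma sublinear_zero: "sublinear p \<Longrightarrow> p 0 = 0"
  using sublinear_scaleR[of p 2 0] by simp

lemma sublinear_minus: "sublinear p \<Longrightarrow> - p (- x) \<le> p x"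
  using sublinear_add[of p x "- x"] sublinear_zero[of p] by simp

text \<open>The largest sublinear functional below \<open>p\<close> whose value at
  \<open>- z\<close> is at most \<open>- p z\<close>. Any linear functional below it therefore
  agrees with \<open>p\<close> at \<open>z\<close>.\<close>

definition sublinear_descent :: "('a::real_vector \<Rightarrow> real) \<Rightarrow> 'a \<Rightarrow> 'a \<Rightarrow> real" where
  "sublinear_descent p z x = (INF t\<in>{0..}. p (x + t *\<^sub>R z) - t * p z)"

context
  fixes p :: "'a::real_vector \<Rightarrow> real" and z :: 'a
  assumes p: "sublinear p"
begin

lemma sublinear_scaleR_nonneg: "0 \<le> t \<Longrightarrow> p (t *\<^sub>R x) = t * p x"
  using sublinear_scaleR[OF p] sublinear_zero[OF p] by (cases "t = 0") auto

lemma sublinear_descent_le: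
  assumes "0 \<le> t" shows "sublinear_descent p z x \<le> p (x + t *\<^sub>R z) - t * p z"
proof -
  \<comment> \<open>The infimum over the reals is meaningful only with this lower bound, which does
    not depend on \<open>s\<close>.\<close>
  have "- p (- x) \<le> p (x + s *\<^sub>R z) - s * p z" if "0 \<le> s" for s
    using sublinear_add[OF p, of "x + s *\<^sub>R z" "- x"] sublinear_scaleR_nonneg[OF that] by simp
  then have "bdd_below ((\<lambda>t. p (x + t *\<^sub>R z) - t * p z) ` {0..})"
    by (intro bdd_belowI[of _ "- p (- x)"]) auto
  then show ?thesis
    unfolding sublinear_descent_def using assms by (intro cINF_lower) auto
qed

lemma sublinear_descent_greatest:
  assumes "\<And>t. 0 \<le> t \<Longrightarrow> c \<le> p (x + t *\<^sub>R z) - t * p z"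
  shows "c \<le> sublinear_descent p z x"
  unfolding sublinear_descent_def using assms by (intro cINF_greatest) auto

lemma sublinear_descent_le_self: "sublinear_descent p z x \<le> p x"
  using sublinear_descent_le[of 0 x] by simp

lemma sublinear_descent_minus: "sublinear_descent p z (- z) \<le> - p z"
  using sublinear_descent_le[of 1 "- z"] sublinear_zero[OF p] by simp

text \<open>Parameters \<open>t\<close> for \<open>x\<close> and \<open>s\<close> for
  \<open>y\<close> combine to \<open>t + s\<close> for \<open>x + y\<close>, and the two infima are
  taken one after the other. For scaling by \<open>t\<close>, the parameter \<open>s\<close> becomes
  \<open>t * s\<close>.\<close>

lemma sublinear_sublinear_descent: "sublinear (sublinear_descent p z)"
proof (rule sublinearI)
  fix x y
  have *: "sublinear_descent p z (x + y) - (p (y + s *\<^sub>R z) - s * p z) \<le> sublinear_descent p z x"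
    if "0 \<le> s" for s
  proof (rule sublinear_descent_greatest)
    fix t :: real assume "0 \<le> t"
    then show "sublinear_descent p z (x + y) - (p (y + s *\<^sub>R z) - s * p z)
        \<le> p (x + t *\<^sub>R z) - t * p z"
      using sublinear_descent_le[of "t + s" "x + y"] that
        sublinear_add[OF p, of "x + t *\<^sub>R z" "y + s *\<^sub>R z"]
      by (simp add: algebra_simps)
  qed
  have "sublinear_descent p z (x + y) - sublinear_descent p z x \<le> sublinear_descent p z y"
    using * by (intro sublinear_descent_greatest) (simp add: algebra_simps)
  then show "sublinear_descent p z (x + y) \<le> sublinear_descent p z x + sublinear_descent p z y"
    by simp
next
  fix t :: real and x :: 'a assume t: "0 < t"
  have "inverse t * sublinear_descent p z (t *\<^sub>R x) \<le> sublinear_descent p z x"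
  proof (rule sublinear_descent_greatest)
    fix s :: real assume "0 \<le> s"
    then have "sublinear_descent p z (t *\<^sub>R x) \<le> p (t *\<^sub>R (x + s *\<^sub>R z)) - t * s * p z"
      using sublinear_descent_le[of "t * s" "t *\<^sub>R x"] t by (simp add: algebra_simps)
    also have "\<dots> = t * (p (x + s *\<^sub>R z) - s * p z)"
      unfolding sublinear_scaleR[OF p t] by (simp add: algebra_simps)
    finally show "inverse t * sublinear_descent p z (t *\<^sub>R x) \<le> p (x + s *\<^sub>R z) - s * p z"
      using t by (simp add: field_simps)
  qed
  then show "sublinear_descent p z (t *\<^sub>R x) \<le> t * sublinear_descent p z x"
    using t by (simp add: field_simps)
qed

end

text \<open>This yields Hahn-Banach without partially defined functionals: Zorn's lemma is applied to
  sublinear functionals on the whole space.\<close>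

lemma linear_if_minimal_sublinear:
  fixes p :: "'a::real_vector \<Rightarrow> real"
  assumes p: "sublinear p" and min: "\<And>r. sublinear r \<Longrightarrow> r \<le> p \<Longrightarrow> r = p"
  shows "linear p"
proof -
  \<comment> \<open>By minimality the descent in any direction changes nothing. Its value at
    \<open>- z\<close> then makes \<open>p\<close> odd, and oddness turns subadditivity into
    additivity.\<close>
  have eq: "sublinear_descent p z = p" for z
    using p by (intro min sublinear_sublinear_descent) (auto simp: le_fun_def sublinear_descent_le_self)
  have neg: "p (- z) = - p z" for z
    using sublinear_descent_minus[OF p, of z] sublinear_minus[OF p, of z] unfolding eq by simp
  have add: "p (x + y) = p x + p y" for x y
    using sublinear_add[OF p, of x y] sublinear_add[OF p, of "- x" "- y"] neg[of "x + y"]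
      neg[of x] neg[of y] by simp
  have "p (t *\<^sub>R x) = t * p x" for t x
    using sublinear_scaleR_nonneg[OF p, of t x] sublinear_scaleR_nonneg[OF p, of "- t" x] neg[of "t *\<^sub>R x"]
    by (cases "0 \<le> t") auto
  with add show ?thesis by (intro linearI) auto
qed

text \<open>Zorn's lemma for the reversed order yields a minimal sublinear functional below
  \<open>p\<close>, which is linear. A nonempty chain is bounded by its pointwise infimum.\<close>

lemma exists_linear_below_sublinear:
  fixes p :: "'a::real_vector \<Rightarrow> real"
  assumes p: "sublinear p"
  obtains f where "linear f" "f \<le> p"
proof -
  let ?A = "{r. sublinear r \<and> r \<le> p}"
  have "\<exists>m\<in>?A. \<forall>a\<in>?A. m \<ge> a \<longrightarrow> a = m"
  proof (rule predicate_Zorn)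
    show "partial_order_on ?A (relation_of (\<ge>) ?A)"
      by (rule partial_order_on_relation_ofI) auto
    fix C assume "C \<in> Chains (relation_of (\<ge>) ?A)"
    then have C: "\<And>r. r \<in> C \<Longrightarrow> sublinear r" "\<And>r. r \<in> C \<Longrightarrow> r \<le> p"
      and tot: "\<And>r s. r \<in> C \<Longrightarrow> s \<in> C \<Longrightarrow> r \<le> s \<or> s \<le> r"
      unfolding Chains_def relation_of_def by auto
    show "\<exists>u\<in>?A. \<forall>a\<in>C. a \<ge> u"
    proof (cases "C = {}")
      case True then show ?thesis using p by auto
    next
      case False
      define u where "u x = (INF r\<in>C. r x)" for x
      have "- p (- x) \<le> r x" if "r \<in> C" for r x
        using sublinear_minus[OF C(1)[OF that], of x] le_funD[OF C(2)[OF that], of "- x"] by simp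
      then have "bdd_below ((\<lambda>r. r x) ` C)" for x
        by (intro bdd_belowI[of _ "- p (- x)"]) auto
      then have low: "u x \<le> r x" if "r \<in> C" for r x
        unfolding u_def using that by (intro cINF_lower)
      have great: "c \<le> u x" if "\<And>r. r \<in> C \<Longrightarrow> c \<le> r x" for c x
        unfolding u_def using that False by (intro cINF_greatest)
      have "sublinear u"
      proof (rule sublinearI)
        fix x y
        \<comment> \<open>Comparability in the chain lets the smaller of \<open>r\<close> and
          \<open>s\<close> serve for both arguments.\<close>
        have *: "u (x + y) \<le> r x + s y" if rs: "r \<in> C" "s \<in> C" for r s
          using tot[OF rs]
        proof
          assume "r \<le> s"
          then show ?thesis
            using low[OF rs(1), of "x + y"] sublinear_add[OF C(1)[OF rs(1)], of x y]
            by (auto simp: le_fun_def dest!: spec[of _ y])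
        next
          assume "s \<le> r"
          then show ?thesis
            using low[OF rs(2), of "x + y"] sublinear_add[OF C(1)[OF rs(2)], of x y]
            by (auto simp: le_fun_def dest!: spec[of _ x])
        qed
        have "u (x + y) - r x \<le> u y" if "r \<in> C" for r
          using *[OF that] by (intro great) (simp add: algebra_simps)
        then have "u (x + y) - u y \<le> u x"
          by (intro great) (simp add: algebra_simps)
        then show "u (x + y) \<le> u x + u y" by simp
      next
        fix t :: real and x assume t: "0 < t"
        have "inverse t * u (t *\<^sub>R x) \<le> u x"
        proof (rule great)
          fix r assume r: "r \<in> C"
          then show "inverse t * u (t *\<^sub>R x) \<le> r x"
            using low[OF r, of "t *\<^sub>R x"] sublinear_scaleR[OF C(1)[OF r] t, of x] t
            by (simp add: field_simps)
        qed
        then show "u (t *\<^sub>R x) \<le> t * u x" using t by (simp add: field_simps)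
      qed
      moreover have "u \<le> p"
        using False low C(2) unfolding le_fun_def by (meson ex_in_conv order_trans)
      ultimately show ?thesis
        using low by (intro bexI[of _ u]) (auto simp: le_fun_def)
    qed
  qed
  then obtain m where m: "sublinear m" "m \<le> p" "\<And>a. sublinear a \<Longrightarrow> a \<le> m \<Longrightarrow> a = m"
    by (metis (mono_tags, lifting) mem_Collect_eq order_trans)
  then show ?thesis using that linear_if_minimal_sublinear by blast
qed

text \<open>A linear functional below the descent of the norm at \<open>z\<close> is bounded by the
  norm and is forced to attain it at \<open>z\<close>.\<close>

lemma exists_norming_functional:
  fixes z :: "'a::real_normed_vector"
  obtains f :: "'a \<Rightarrow> real" where "bounded_linear f" "f z = norm z"
proof -
  have n: "sublinear (norm :: 'a \<Rightarrow> real)"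
    by (intro sublinearI) (auto simp: norm_triangle_ineq)
  obtain f where f: "linear f" "f \<le> sublinear_descent norm z"
    using exists_linear_below_sublinear[OF sublinear_sublinear_descent[OF n]] by blast
  have le: "f x \<le> norm x" for x
    using f(2) sublinear_descent_le_self[OF n] by (meson le_fun_def order_trans)
  have "norm (f x) \<le> norm x * 1" for x
    using le[of x] le[of "- x"] linear_neg[OF f(1), of x] by simp
  then have "bounded_linear f"
    using f(1) by (intro bounded_linear_intro[where K = 1]) (auto simp: linear_add linear_scale)
  moreover have "f (- z) \<le> - norm z"
    using f(2) sublinear_descent_minus[OF n, of z] by (meson le_fun_def order_trans)
  then have "f z = norm z"
    using le[of z] linear_neg[OF f(1), of z] by simp
  ultimately show ?thesis using that by blast
qed

section \<open>Biorthogonal systems\<close>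

locale complex_banach =
  fixes sc :: "complex \<Rightarrow> 'a::banach \<Rightarrow> 'a"
  assumes sc: "complex_banach_scale sc"
begin

sublocale cs: vector_space sc
  using sc unfolding complex_banach_scale_def by blast

lemma sc_of_real: "sc (complex_of_real r) x = r *\<^sub>R x"
  and norm_sc: "norm (sc c x) = cmod c * norm x"
  using sc unfolding complex_banach_scale_def by blast+

lemma sc_mult_of_real: "sc (complex_of_real r * c) x = r *\<^sub>R sc c x"
  and sc_scaleR: "sc c (r *\<^sub>R x) = r *\<^sub>R sc c x"
  by (metis cs.scale_scale sc_of_real, metis cs.scale_scale sc_of_real mult.commute)

lemma bounded_bilinear_sc: "bounded_bilinear sc"
proof
  show "sc (r *\<^sub>R a) b = r *\<^sub>R sc a b" "sc a (r *\<^sub>R b) = r *\<^sub>R sc a b" for r a b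
    by (simp_all add: sc_mult_of_real sc_scaleR scaleR_conv_of_real)
  show "\<exists>K. \<forall>a b. norm (sc a b) \<le> norm a * norm b * K"
    by (intro exI[of _ 1]) (simp add: norm_sc)
qed (simp_all add: cs.scale_left_distrib cs.scale_right_distrib)

text \<open>\<open>bounded_linear\<close> only expresses real linearity, hence the separate clause
  for complex scalars.\<close>

definition dual :: "('a \<Rightarrow> complex) set" where
  "dual = {\<phi>. bounded_linear \<phi> \<and> (\<forall>c x. \<phi> (sc c x) = c * \<phi> x)}"

lemma dual_bounded_linear: "\<phi> \<in> dual \<Longrightarrow> bounded_linear \<phi>"
  and dual_scale: "\<phi> \<in> dual \<Longrightarrow> \<phi> (sc c x) = c * \<phi> x"
  unfolding dual_def by auto

lemma dual_add: "\<phi> \<in> dual \<Longrightarrow> \<phi> (x + y) = \<phi> x + \<phi> y"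
  and dual_diff: "\<phi> \<in> dual \<Longrightarrow> \<phi> (x - y) = \<phi> x - \<phi> y"
  and dual_sum: "\<phi> \<in> dual \<Longrightarrow> \<phi> (sum g A) = (\<Sum>i\<in>A. \<phi> (g i))"
  using dual_bounded_linear by (auto simp: linear_simps bounded_linear.linear linear_sum)

text \<open>A real norming functional \<open>f\<close> is the real part of the complex functional
  \<open>f x - \<i> * f (\<i> x)\<close>, which is then normalised at \<open>v\<close>.\<close>

lemma exists_dual_eq_one:
  assumes "v \<noteq> 0"
  obtains \<phi> where "\<phi> \<in> dual" "\<phi> v = 1"
proof -
  obtain f :: "'a \<Rightarrow> real" where f: "bounded_linear f" "f v = norm v"
    by (rule exists_norming_functional)
  interpret f: bounded_linear f by fact
  define F where "F x = complex_of_real (f x) - \<i> * of_real (f (sc \<i> x))" for x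
  have F: "bounded_linear F"
    unfolding F_def
    by (intro bounded_linear_sub bounded_linear_compose[OF bounded_linear_of_real f(1)]
        bounded_linear_const_mult bounded_linear_compose[OF bounded_linear_of_real]
        bounded_linear_compose[OF f(1)] bounded_bilinear.bounded_linear_right[OF bounded_bilinear_sc])
  have "F (sc c x) = c * F x" for c x
  proof -
    have "f (sc c x) = Re c * f x + Im c * f (sc \<i> x)" for c x
    proof -
      have "sc c x = Re c *\<^sub>R x + Im c *\<^sub>R sc \<i> x"
        using cs.scale_left_distrib[of "of_real (Re c)" "of_real (Im c) * \<i>" x]
        unfolding sc_mult_of_real sc_of_real by (simp add: mult.commute[of _ \<i>] flip: complex_eq)
      then show ?thesis by (simp add: f.add f.scaleR)
    qed
    note expand = this
    show ?thesis
      unfolding F_def cs.scale_scale expand[of c] expand[of "\<i> * c"]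
      by (auto simp: complex_eq_iff algebra_simps)
  qed
  moreover have "F v \<noteq> 0"
    using f(2) assms by (auto simp: F_def complex_eq_iff)
  ultimately have "(\<lambda>x. inverse (F v) * F x) \<in> dual" "inverse (F v) * F v = 1"
    using F by (auto simp: dual_def intro: bounded_linear_const_mult)
  then show ?thesis using that by blast
qed

text \<open>A Gram-Schmidt process for pairs of a vector and a functional runs along a dense
  sequence \<open>x\<close>. Stage \<open>n\<close> puts \<open>x n\<close> into the span of the
  vectors found so far, so the final span is dense.\<close>

lemma exists_biorthogonal_system:
  assumes "separable_space (euclidean :: 'a topology)" "infinite_dim_complex sc"
  obtains e :: "nat \<Rightarrow> 'a" and \<phi> :: "nat \<Rightarrow> 'a \<Rightarrow> complex" where "\<And>k. norm (e k) = 1" "\<And>k. \<phi> k \<in> dual"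
    "\<And>i j. \<phi> i (e j) = (if i = j then 1 else 0)" "closure (cs.span (range e)) = UNIV"
proof -
  obtain C :: "'a set" where C: "countable C" "closure C = UNIV"
    using assms(1) unfolding separable_space_def by auto
  then have "C \<noteq> {}" by auto
  define x where "x = from_nat_into C"
  have x: "range x = C"
    unfolding x_def using C \<open>C \<noteq> {}\<close> by simp
  define P :: "(nat \<Rightarrow> 'a \<times> ('a \<Rightarrow> complex)) \<Rightarrow> nat \<Rightarrow> 'a \<times> ('a \<Rightarrow> complex) \<Rightarrow> bool" where
    "P g n r \<longleftrightarrow> norm (fst r) = 1 \<and> snd r \<in> dual \<and> snd r (fst r) = 1 \<and>
       (\<forall>i<n. snd r (fst (g i)) = 0 \<and> snd (g i) (fst r) = 0) \<and>
       x n \<in> cs.span (insert (fst r) ((\<lambda>i. fst (g i)) ` {..<n}))" for g n r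
  have "\<exists>g. \<forall>n. P g n (g n)"
  proof (rule dependent_wellorder_choice)
    fix r :: "'a \<times> ('a \<Rightarrow> complex)" and g h :: "nat \<Rightarrow> 'a \<times> ('a \<Rightarrow> complex)" and n :: nat
    assume "\<And>y. y < n \<Longrightarrow> g y = h y"
    then show "P g n r = P h n r"
      unfolding P_def by (auto cong: image_cong_simp)
  next
    fix n :: nat and g :: "nat \<Rightarrow> 'a \<times> ('a \<Rightarrow> complex)" assume IH: "\<And>y. y < n \<Longrightarrow> P g y (g y)"
    define e where "e i = fst (g i)" for i
    define \<phi> where "\<phi> i = snd (g i)" for i
    have dual: "\<phi> i \<in> dual" if "i < n" for i
      using IH[OF that] by (simp add: P_def \<phi>_def)
    have orth: "\<phi> i (e j) = (if i = j then 1 else 0)" if "i < n" "j < n" for i j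
      using IH[OF that(1)] IH[OF that(2)] by (cases i j rule: linorder_cases) (auto simp: P_def \<phi>_def e_def)
    let ?S = "cs.span (e ` {..<n})"
    \<comment> \<open>If \<open>x n\<close> already lies in the span, infinite dimension supplies
      some other new direction, so that every stage adds a vector.\<close>
    obtain y where y: "y \<notin> ?S" "x n \<in> ?S \<or> y = x n"
    proof (cases "x n \<in> ?S")
      case True
      moreover have "?S \<noteq> UNIV"
        using assms(2) unfolding infinite_dim_complex_def by blast
      ultimately show ?thesis using that by auto
    qed (use that in auto)
    \<comment> \<open>Subtracting the components of \<open>y\<close> makes all earlier functionals
      vanish at \<open>w\<close>.\<close>
    define w where "w = y - (\<Sum>i<n. sc (\<phi> i y) (e i))"
    have S: "(\<Sum>i<n. sc (\<phi> i y) (e i)) \<in> ?S"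
      by (intro cs.span_sum cs.span_scale cs.span_base) auto
    then have "w \<noteq> 0" using y(1) unfolding w_def by auto
    have \<phi>w: "\<phi> i w = 0" if "i < n" for i
    proof -
      have "(\<Sum>j<n. \<phi> j y * \<phi> i (e j)) = (\<Sum>j<n. if i = j then \<phi> j y else 0)"
        using that by (intro sum.cong) (auto simp: orth)
      then show ?thesis
        using that dual[OF that] by (simp add: w_def dual_diff dual_sum dual_scale)
    qed
    define v where "v = sc (of_real (inverse (norm w))) w"
    have v: "norm v = 1" using \<open>w \<noteq> 0\<close> by (simp add: v_def norm_sc norm_inverse)
    then have "v \<noteq> 0" by auto
    then obtain \<psi> where \<psi>: "\<psi> \<in> dual" "\<psi> v = 1" by (rule exists_dual_eq_one)
    have \<phi>v: "\<phi> i v = 0" if "i < n" for i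
      using \<phi>w[OF that] dual[OF that] by (simp add: v_def dual_scale)
    \<comment> \<open>The dual correction: \<open>\<theta>\<close> vanishes at the earlier vectors
      and keeps the value 1 at \<open>v\<close>, because every earlier \<open>\<phi> i\<close>
      vanishes there.\<close>
    define \<theta> where "\<theta> z = \<psi> z - (\<Sum>i<n. \<psi> (e i) * \<phi> i z)" for z
    have "\<theta> \<in> dual"
      unfolding dual_def
    proof (intro CollectI conjI allI)
      show "bounded_linear \<theta>"
        unfolding \<theta>_def using dual \<psi>
        by (intro bounded_linear_sub bounded_linear_sum bounded_linear_const_mult)
           (auto intro: dual_bounded_linear)
      show "\<theta> (sc c z) = c * \<theta> z" for c z
        using dual \<psi> by (simp add: \<theta>_def dual_scale algebra_simps sum_distrib_left)
    qed
    moreover have "\<theta> v = 1"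
      using \<psi> \<phi>v by (simp add: \<theta>_def)
    moreover have "\<theta> (e i) = 0" if "i < n" for i
    proof -
      have "(\<Sum>j<n. \<psi> (e j) * \<phi> j (e i)) = (\<Sum>j<n. if i = j then \<psi> (e j) else 0)"
        using that by (intro sum.cong) (auto simp: orth)
      then show ?thesis using that by (simp add: \<theta>_def)
    qed
    moreover have "x n \<in> cs.span (insert v (e ` {..<n}))" (is "_ \<in> ?S'")
    proof -
      have sub: "?S \<subseteq> ?S'" by (intro cs.span_mono) auto
      have "w = sc (of_real (norm w)) v"
        using \<open>w \<noteq> 0\<close> by (simp add: v_def flip: of_real_mult)
      then have "w \<in> ?S'"
        by (metis cs.span_base cs.span_scale insertI1)
      then have "y \<in> ?S'"
        using S sub cs.span_add[of w _ "\<Sum>i<n. sc (\<phi> i y) (e i)"] by (auto simp: w_def)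
      then show ?thesis using y(2) sub by auto
    qed
    ultimately show "\<exists>r. P g n r"
      using v \<phi>v unfolding P_def e_def \<phi>_def by (intro exI[of _ "(v, \<theta>)"]) auto
  qed
  then obtain g where g: "\<And>n. P g n (g n)" by blast
  show ?thesis
  proof (rule that[of "\<lambda>n. fst (g n)" "\<lambda>n. snd (g n)"])
    show "norm (fst (g k)) = 1" "snd (g k) \<in> dual" for k
      using g[of k] by (auto simp: P_def)
    show "snd (g i) (fst (g j)) = (if i = j then 1 else 0)" for i j
      using g[of i] g[of j] by (cases i j rule: linorder_cases) (auto simp: P_def)
    have "x n \<in> cs.span (range (\<lambda>n. fst (g n)))" for n
      using g[of n] cs.span_mono[of "insert (fst (g n)) ((\<lambda>i. fst (g i)) ` {..<n})" "range (\<lambda>n. fst (g n))"]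
      by (auto simp: P_def)
    then have "C \<subseteq> cs.span (range (\<lambda>n. fst (g n)))"
      using x by auto
    then show "closure (cs.span (range (\<lambda>n. fst (g n)))) = UNIV"
      using C(2) closure_mono by blast
  qed
qed

end

section \<open>The operator\<close>

lemma norm_cis_minus_one: "norm (cis t - 1) = 2 * \<bar>sin (t / 2)\<bar>"
  using dist_exp_i_1[of t] by (simp add: cis_conv_exp)

lemma norm_cis_minus_one_le: "norm (cis t - 1) \<le> \<bar>t\<bar>"
  using abs_sin_x_le_abs_x[of "t / 2"] unfolding norm_cis_minus_one by simp

text \<open>Mean value theorem: the derivative \<open>cos\<close> is at least 1/2 up to
  \<open>pi / 3\<close>.\<close>

lemma sin_ge_half_self:
  fixes x :: real
  assumes "0 \<le> x" "x \<le> pi / 3"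
  shows "x / 2 \<le> sin x"
proof (cases "x = 0")
  case False
  then obtain z where z: "0 < z" "z < x" "sin x - sin 0 = (x - 0) * cos z"
    using MVT2[of 0 x sin cos] assms by auto
  have "cos (pi / 3) \<le> cos z"
    using z assms by (intro cos_monotone_0_pi_le) auto
  then have "x * (1 / 2) \<le> x * cos z"
    using assms by (intro mult_left_mono) (simp_all add: cos_60)
  with z show ?thesis by simp
qed simp

lemma norm_cis_minus_one_ge:
  assumes "0 \<le> t" "t \<le> 2 * pi / 3"
  shows "t / 2 \<le> norm (cis t - 1)"
  using sin_ge_half_self[of "t / 2"] assms unfolding norm_cis_minus_one by simp

section \<open>The data of the construction\<close>

locale biorthogonal_system = complex_banach sc
  for sc :: "complex \<Rightarrow> 'a::banach \<Rightarrow> 'a" +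
  fixes e :: "nat \<Rightarrow> 'a" and \<phi> :: "nat \<Rightarrow> 'a \<Rightarrow> complex" and d :: "nat \<Rightarrow> complex"
  assumes norm_e: "norm (e k) = 1"
    and \<phi>_dual: "\<phi> k \<in> dual"
    and \<phi>_e: "\<phi> i (e j) = (if i = j then 1 else 0)"
    and dense: "closure (cs.span (range e)) = UNIV"
begin

abbreviation b :: "nat \<Rightarrow> 'a" where "b k \<equiv> e (k + 2)"

definition B :: "nat \<Rightarrow> real" where "B k = 1 + onorm (\<phi> (k + 2))"

definition A :: "nat \<Rightarrow> nat" where "A k = nat \<lceil>B k * (1 + cmod (d k))\<rceil>"

text \<open>Divisibility makes \<open>lam k ^ q K = 1\<close> for \<open>k < K\<close>. The powers
  of 4 give geometric decay, and the integer \<open>A k\<close> absorbs the norms of the functionals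
  that occur in \<open>h k\<close>.\<close>

primrec q :: "nat \<Rightarrow> nat" where
  "q 0 = A 0"
| "q (Suc k) = q k * (4 ^ Suc k * A (Suc k))"

declare q.simps [simp del]

definition lam :: "nat \<Rightarrow> complex" where "lam k = cis (2 * pi / q (Suc k))"

text \<open>The added multiple of \<open>\<phi> 1 - d k * \<phi> 0\<close> vanishes at every
  \<open>b j\<close>, so biorthogonality survives. Its weight is large enough to offset the
  smallness of \<open>lam k ^ N - 1\<close> when \<open>q k \<le> 4 * N < q (Suc k)\<close>, while
  \<open>lam k - 1\<close>, of order \<open>1 / q (Suc k)\<close>, still makes the series for
  \<open>T\<close> converge.\<close>

definition h :: "nat \<Rightarrow> 'a \<Rightarrow> complex" where
  "h k x = \<phi> (k + 2) x + of_real (B k * q (Suc k) / q k) * (\<phi> 1 x - d k * \<phi> 0 x)"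

definition T :: "'a \<Rightarrow> 'a" where
  "T x = x + (\<Sum>k. sc ((lam k - 1) * h k x) (b k))"

lemma B_ge_1: "1 \<le> B k"
  unfolding B_def using onorm_pos_le[OF dual_bounded_linear[OF \<phi>_dual]] by simp

lemma norm_\<phi>_le: "cmod (\<phi> (k + 2) x) \<le> B k * norm x"
proof -
  have "cmod (\<phi> (k + 2) x) \<le> onorm (\<phi> (k + 2)) * norm x"
    by (rule onorm[OF dual_bounded_linear[OF \<phi>_dual]])
  also have "\<dots> \<le> B k * norm x" by (simp add: B_def mult_right_mono)
  finally show ?thesis .
qed

lemma A_ge: "B k * (1 + cmod (d k)) \<le> A k"
  unfolding A_def by linarith

lemma B_le_A: "B k \<le> A k"
proof -
  have "B k * 1 \<le> B k * (1 + cmod (d k))"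
    using B_ge_1[of k] by (intro mult_left_mono) auto
  then show ?thesis using A_ge[of k] by simp
qed

lemma A_pos: "0 < A k"
  using B_le_A[of k] B_ge_1[of k] by simp

lemma q_pos: "0 < q k"
  by (induction k) (simp_all add: q.simps A_pos)

lemma q_dvd: "j \<le> k \<Longrightarrow> q j dvd q k"
  by (induction k rule: dec_induct) (auto simp: q.simps intro: dvd_mult2)

lemma strict_mono_q: "strict_mono q"
proof (rule strict_monoI_Suc)
  fix k
  have "1 < 4 ^ Suc k * A (Suc k)"
    using A_pos[of "Suc k"] one_less_power[of "4::nat" "Suc k"]
    by (intro less_le_trans[OF _ mult_le_mono2[of 1 "A (Suc k)" "4 ^ Suc k"]]) auto
  then show "q k < q (Suc k)" using q_pos[of k] by (simp add: q.simps)
qed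

lemma q_ge: "2 ^ k * A k \<le> q k"
proof (cases k)
  case (Suc j)
  have "(2::nat) ^ Suc j \<le> 4 ^ Suc j" by (intro power_mono) auto
  then have "1 * (2 ^ k * A k) \<le> q j * (4 ^ Suc j * A (Suc j))"
    unfolding Suc using q_pos[of j] by (intro mult_mono) auto
  then show ?thesis using Suc by (simp add: q.simps)
qed (simp add: q.simps)

text \<open>The factor \<open>4 ^ k\<close> in the recursion dominates \<open>2 ^ K * 2 ^ k\<close>.
  In the tail of \<open>(T ^^ q K) x - x\<close>, the power of \<open>k\<close> gives summability
  and the power of \<open>K\<close> makes the sum tend to 0.\<close>

lemma q_growth:
  assumes "K < k" shows "q K * (2 ^ K * 2 ^ k * A k) \<le> q k"
proof -
  obtain j where k: "k = Suc j" using assms by (cases k) auto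
  have "(2::nat) ^ K * 2 ^ k \<le> 2 ^ k * 2 ^ k" using assms by simp
  also have "\<dots> = 4 ^ k" by (simp flip: power_mult_distrib)
  finally have "q K * (2 ^ K * 2 ^ k * A k) \<le> q j * (4 ^ k * A k)"
    using assms k strict_mono_less_eq[OF strict_mono_q, of K j] by (intro mult_mono) auto
  then show ?thesis by (simp add: k q.simps)
qed

lemma norm_lam [simp]: "cmod (lam k) = 1"
  by (simp add: lam_def)

lemma lam_power: "lam k ^ N = cis (2 * pi * N / q (Suc k))"
proof -
  have "real N * (2 * pi / q (Suc k)) = 2 * pi * N / q (Suc k)" by simp
  then show ?thesis unfolding lam_def Complex.DeMoivre by (rule arg_cong)
qed

lemma norm_lam_power_minus_one_le: "cmod (lam k ^ N - 1) \<le> N * (2 * pi / q (Suc k))"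
  using norm_cis_minus_one_le[of "2 * pi * N / q (Suc k)"] unfolding lam_power by (simp add: mult_ac)

lemma lam_power_eq_one: "q (Suc k) dvd N \<Longrightarrow> lam k ^ N = 1"
proof -
  assume "q (Suc k) dvd N"
  then obtain m where "N = q (Suc k) * m" ..
  moreover have "lam k ^ q (Suc k) = 1"
    unfolding lam_power using q_pos[of "Suc k"] by simp
  ultimately show ?thesis by (simp add: power_mult)
qed

section \<open>Coordinate functionals, convergence of the series and powers of the operator\<close>

lemma h_dual: "h k \<in> dual"
  unfolding dual_def
proof (intro CollectI conjI allI)
  show "bounded_linear (h k)"
    unfolding h_def[abs_def]
    by (intro bounded_linear_add bounded_linear_const_mult bounded_linear_sub
        dual_bounded_linear \<phi>_dual)
  show "h k (sc c x) = c * h k x" for c x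
    by (simp add: h_def dual_scale[OF \<phi>_dual] algebra_simps)
qed

lemma h_b: "h j (b k) = (if j = k then 1 else 0)"
  by (simp add: h_def \<phi>_e)

text \<open>\<open>M - 1\<close> bounds the norms of \<open>\<phi> 0\<close> and
  \<open>\<phi> 1\<close>; the additional 1 accounts for the term \<open>\<phi> (k + 2)\<close> of
  \<open>h k\<close>.\<close>

definition M :: real where "M = 1 + onorm (\<phi> 0) + onorm (\<phi> 1)"

lemma M_ge_1: "1 \<le> M"
  unfolding M_def by (intro add_increasing2 onorm_pos_le dual_bounded_linear \<phi>_dual) auto

lemma norm_\<phi>_diff_le: "cmod (\<phi> 1 x - d k * \<phi> 0 x) \<le> (1 + cmod (d k)) * ((M - 1) * norm x)"
proof -
  have le: "cmod (\<phi> i x) \<le> (M - 1) * norm x" if "i \<in> {0, 1}" for i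
  proof -
    have "cmod (\<phi> i x) \<le> onorm (\<phi> i) * norm x"
      by (intro onorm dual_bounded_linear \<phi>_dual)
    also have "\<dots> \<le> (M - 1) * norm x"
      using that onorm_pos_le[OF dual_bounded_linear[OF \<phi>_dual]]
      by (intro mult_right_mono) (auto simp: M_def)
    finally show ?thesis .
  qed
  have "cmod (\<phi> 1 x - d k * \<phi> 0 x) \<le> cmod (\<phi> 1 x) + cmod (d k) * cmod (\<phi> 0 x)"
    using norm_triangle_ineq4[of "\<phi> 1 x" "d k * \<phi> 0 x"] by (simp add: norm_mult)
  also have "\<dots> \<le> (M - 1) * norm x + cmod (d k) * ((M - 1) * norm x)"
    using le by (intro add_mono mult_left_mono) auto
  finally show ?thesis by (simp add: algebra_simps)
qed

text \<open>The estimate \<open>2 * pi / q (Suc k)\<close> for the first factor cancels the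
  numerator of the weight in \<open>h k\<close>, leaving \<open>A k / q k\<close>, which is at most
  \<open>(1 / 2) ^ k\<close>.\<close>

lemma lam_h_bound:
  "cmod (lam k - 1) * cmod (h k x) \<le> 2 * pi * M * (1 / 2) ^ k * norm x"
proof -
  let ?R = "real (q (Suc k))" and ?r = "real (q k)"
  have pos: "0 < ?R" "0 < ?r" "0 < real (A k)" "0 \<le> B k" "0 \<le> M - 1"
    using q_pos A_pos B_ge_1[of k] M_ge_1 by simp_all
  have rR: "?r \<le> ?R"
    using strict_mono_less_eq[OF strict_mono_q, of k "Suc k"] by simp
  have "cmod (h k x) \<le> B k * norm x + B k * ?R / ?r * ((1 + cmod (d k)) * ((M - 1) * norm x))"
  proof -
    have "cmod (h k x) \<le> cmod (\<phi> (k + 2) x)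
        + cmod (of_real (B k * ?R / ?r) * (\<phi> 1 x - d k * \<phi> 0 x))"
      unfolding h_def by (rule norm_triangle_ineq)
    also have "\<dots> \<le> B k * norm x + B k * ?R / ?r * ((1 + cmod (d k)) * ((M - 1) * norm x))"
      unfolding norm_mult norm_of_real using pos
      by (intro add_mono norm_\<phi>_le mult_mono norm_\<phi>_diff_le) auto
    finally show ?thesis .
  qed
  also have "\<dots> \<le> ?R / ?r * (A k * (M * norm x))"
  proof -
    have "B k * norm x \<le> ?R / ?r * (A k * norm x)"
      using B_le_A[of k] mult_mono[of 1 "?R / ?r" "B k * norm x" "A k * norm x"] rR pos
      by (simp add: mult_right_mono)
    moreover have "B k * ?R / ?r * ((1 + cmod (d k)) * ((M - 1) * norm x))
        \<le> ?R / ?r * (A k * ((M - 1) * norm x))"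
      using mult_right_mono[OF A_ge[of k], of "?R / ?r * ((M - 1) * norm x)"] pos
      by (simp add: mult_ac)
    ultimately show ?thesis by (simp add: algebra_simps)
  qed
  finally have "cmod (lam k - 1) * cmod (h k x) \<le> 2 * pi / ?R * (?R / ?r * (A k * (M * norm x)))"
    using norm_lam_power_minus_one_le[of k 1] by (intro mult_mono) simp_all
  also have "\<dots> = 2 * pi * M * norm x * (A k / ?r)"
    using pos by (simp add: field_simps)
  also have "\<dots> \<le> 2 * pi * M * norm x * (1 / 2) ^ k"
  proof (intro mult_left_mono)
    have "2 ^ k * real (A k) \<le> ?r"
      using q_ge[of k] by (metis of_nat_le_iff of_nat_mult of_nat_numeral of_nat_power)
    then show "A k / ?r \<le> (1 / 2) ^ k"
      using pos by (simp add: field_simps power_divide)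
  qed (use M_ge_1 in simp)
  finally show ?thesis by (simp add: mult_ac)
qed

lemma norm_lam_power_le: "cmod (lam k ^ N - 1) \<le> N * cmod (lam k - 1)"
  using norm_power_diff[of "lam k" 1 N] by simp

lemma summable_coord:
  assumes "\<And>k. cmod (t k) \<le> C * cmod (lam k - 1)"
  shows "summable (\<lambda>k. sc (t k * h k x) (b k))"
proof (rule summable_comparison_test')
  show "summable (\<lambda>k. \<bar>C\<bar> * (2 * pi * M * norm x) * (1 / 2) ^ k)"
    by (intro summable_mult summable_geometric) simp
  fix k
  have "norm (sc (t k * h k x) (b k)) = cmod (t k) * cmod (h k x)"
    by (simp add: norm_sc norm_e norm_mult)
  also have "\<dots> \<le> \<bar>C\<bar> * (cmod (lam k - 1) * cmod (h k x))"
    using order_trans[OF assms[of k] mult_right_mono[OF abs_ge_self[of C]]]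
    by (simp add: mult_right_mono flip: mult.assoc)
  also have "\<dots> \<le> \<bar>C\<bar> * (2 * pi * M * (1 / 2) ^ k * norm x)"
    by (intro mult_left_mono lam_h_bound) simp
  finally show "norm (sc (t k * h k x) (b k)) \<le> \<bar>C\<bar> * (2 * pi * M * norm x) * (1 / 2) ^ k"
    by (simp add: mult_ac)
qed

lemma summable_lam_power: "summable (\<lambda>k. sc ((lam k ^ N - 1) * h k x) (b k))"
  by (rule summable_coord[where C = N]) (rule norm_lam_power_le)

lemma summable_T: "summable (\<lambda>k. sc ((lam k - 1) * h k x) (b k))"
  using summable_lam_power[of 1] by simp

lemma dual_suminf_coord:
  assumes "\<psi> \<in> dual" "\<And>k. \<psi> (b k) = (if j = k then 1 else 0)"
    "summable (\<lambda>k. sc (t k) (b k))"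
  shows "\<psi> (\<Sum>k. sc (t k) (b k)) = t j"
proof -
  have coord: "\<psi> (sc (t k) (b k)) = (if j = k then t k else 0)" for k
    unfolding dual_scale[OF assms(1)] assms(2) by simp
  have "\<psi> (\<Sum>k. sc (t k) (b k)) = (\<Sum>k. if j = k then t k else 0)"
    using bounded_linear.suminf[OF dual_bounded_linear[OF assms(1)] assms(3)] unfolding coord by metis
  also have "\<dots> = (\<Sum>k\<in>{j}. if j = k then t k else 0)"
    by (rule suminf_finite) auto
  finally show ?thesis by simp
qed

text \<open>By biorthogonality \<open>T\<close> multiplies each coordinate \<open>h k\<close> by
  \<open>lam k\<close>, and \<open>(lam k ^ N - 1) + (lam k - 1) * lam k ^ N\<close>
  telescopes.\<close>

lemma T_power: "(T ^^ N) x = x + (\<Sum>k. sc ((lam k ^ N - 1) * h k x) (b k))"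
proof (induction N)
  case (Suc N)
  let ?y = "x + (\<Sum>k. sc ((lam k ^ N - 1) * h k x) (b k))"
  have h: "h k ?y = lam k ^ N * h k x" for k
    using dual_suminf_coord[OF h_dual h_b summable_lam_power, of k N x]
    by (simp add: dual_add[OF h_dual] algebra_simps)
  have "(T ^^ Suc N) x = ?y + (\<Sum>k. sc ((lam k - 1) * h k ?y) (b k))"
    unfolding funpow.simps o_apply Suc.IH by (rule T_def)
  also have "\<dots> = x + (\<Sum>k. sc ((lam k ^ N - 1) * h k x) (b k) + sc ((lam k - 1) * h k ?y) (b k))"
    using suminf_add[OF summable_lam_power summable_T] by (simp add: add.assoc)
  also have "\<dots> = x + (\<Sum>k. sc ((lam k ^ Suc N - 1) * h k x) (b k))"
    unfolding h by (simp add: algebra_simps flip: cs.scale_left_distrib cs.scale_left_diff_distrib)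
  finally show ?case .
qed simp

text \<open>Reading off a single coefficient is how lower bounds for the displacement, and
  convergence of \<open>lam k ^ N\<close>, are obtained later.\<close>

lemma \<phi>_T_power: "\<phi> (k + 2) ((T ^^ N) x - x) = (lam k ^ N - 1) * h k x"
  using dual_suminf_coord[OF \<phi>_dual _ summable_lam_power, of "k + 2" k]
  by (simp add: T_power \<phi>_e)

lemma T_bounded_complex_operator: "bounded_complex_operator sc T"
proof -
  have add: "T (x + y) = T x + T y" for x y
    using suminf_add[OF summable_T summable_T, of x y]
    by (simp add: T_def dual_add[OF h_dual] algebra_simps cs.scale_left_distrib)
  have scale: "T (sc c x) = sc c (T x)" for c x
    using bounded_linear.suminf[OF bounded_bilinear.bounded_linear_right[OF bounded_bilinear_sc] summable_T, of c x]
    by (simp add: T_def dual_scale[OF h_dual] cs.scale_right_distrib mult_ac)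
  have bound: "norm (T x) \<le> norm x * (1 + 4 * pi * M)" for x
  proof -
    have s: "summable (\<lambda>k. 2 * pi * M * norm x * (1 / 2) ^ k)"
      by (intro summable_mult summable_geometric) simp
    have "norm (\<Sum>k. sc ((lam k - 1) * h k x) (b k)) \<le> (\<Sum>k. 2 * pi * M * norm x * (1 / 2) ^ k)"
      using lam_h_bound[of _ x]
      by (intro norm_suminf_le s) (simp add: norm_sc norm_e norm_mult mult_ac)
    also have "\<dots> = 4 * pi * M * norm x"
      using suminf_mult[OF summable_geometric[of "1 / 2 :: real"], of "2 * pi * M * norm x"]
        suminf_geometric[of "1 / 2 :: real"] by simp
    finally show ?thesis
      unfolding T_def by (intro norm_triangle_le) (simp add: algebra_simps)
  qed
  have "bounded_linear T"
    using add scale[of "of_real _"] bound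
    by (intro bounded_linear_intro) (auto simp: sc_of_real)
  moreover have "Vector_Spaces.linear sc sc T"
    unfolding Vector_Spaces.linear_iff using add scale cs.vector_space_axioms by auto
  ultimately show ?thesis unfolding bounded_complex_operator_def by blast
qed

end

section \<open>Return times\<close>

context biorthogonal_system
begin

lemma bounded_linear_T: "bounded_linear T"
  using T_bounded_complex_operator by (simp add: bounded_complex_operator_def)

lemma T_power_linear:
  "(T ^^ N) (x + y) = (T ^^ N) x + (T ^^ N) y" "(T ^^ N) (sc c x) = sc c ((T ^^ N) x)"
proof -
  have "T (sc c x) = sc c (T x)" for c x
    using T_bounded_complex_operator
    by (simp add: bounded_complex_operator_def Vector_Spaces.linear_iff)
  then show "(T ^^ N) (x + y) = (T ^^ N) x + (T ^^ N) y" "(T ^^ N) (sc c x) = sc c ((T ^^ N) x)"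
    by (induction N) (simp_all add: linear_simps[OF bounded_linear_T])
qed

lemma subspace_Lset: "cs.subspace (Lset T \<omega>)"
proof (rule cs.subspaceI)
  show "0 \<in> Lset T \<omega>"
    using T_power_linear(2)[of _ 0 0] by (simp add: Lset_def)
  show "x + y \<in> Lset T \<omega>" if "x \<in> Lset T \<omega>" "y \<in> Lset T \<omega>" for x y
    using that by (auto simp: Lset_def T_power_linear intro: tendsto_add)
  show "sc c x \<in> Lset T \<omega>" if "x \<in> Lset T \<omega>" for c x
    using that
    by (auto simp: Lset_def T_power_linear intro: bounded_bilinear.tendsto[OF bounded_bilinear_sc tendsto_const])
qed

lemma Lset_subsequence:
  assumes "x \<in> Lset T \<omega>" "strict_mono r" shows "x \<in> Lset T (\<omega> \<circ> r)"
proof -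
  have "(\<lambda>n. (T ^^ \<omega> n) x) \<longlonglongrightarrow> x" using assms(1) by (simp add: Lset_def)
  from LIMSEQ_subseq_LIMSEQ[OF this assms(2)] show ?thesis by (simp add: Lset_def o_def)
qed

lemma continuous_on_\<phi>: "continuous_on S (\<phi> k)"
  by (intro linear_continuous_on dual_bounded_linear \<phi>_dual)

text \<open>For a return time \<open>N\<close>, the coordinate \<open>k\<close> with \<open>q k \<le> 4 * N < q (Suc k)\<close> witnesses that
  \<open>(T ^^ N) y\<close> stays away from \<open>y\<close>: there \<open>lam k ^ N\<close> has distance at least of order
  \<open>q k / q (Suc k)\<close> from 1, and this is exactly compensated by the weight in \<open>h k\<close>.\<close>

lemma Lset_\<phi>_one_eq_zero:
  assumes \<omega>: "strict_mono \<omega>" and y: "y \<in> Lset T \<omega>" and "\<phi> 0 y = 0"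
  shows "\<phi> 1 y = 0"
proof (rule ccontr)
  define s where "s = cmod (\<phi> 1 y)"
  assume "\<phi> 1 y \<noteq> 0"
  then have s: "0 < s" by (simp add: s_def)
  \<comment> \<open>Since \<open>q (Suc k) / q k\<close> is at least \<open>k\<close>, for
    \<open>k \<ge> k0\<close> the term of \<open>h k y\<close> with \<open>\<phi> 1 y\<close> is at
    least twice the bound \<open>B k * norm y\<close> for the other term.\<close>
  obtain k0 :: nat where k0: "2 * norm y \<le> k0 * s"
    using reals_Archimedean3[OF s] less_imp_le by blast
  have half_le: "u / 2 \<le> w" if "2 * v \<le> u" "u - v \<le> w" for u v w :: real
    using that by linarith
  have lower: "s / 8 \<le> norm ((T ^^ N) y - y)" if N: "q k0 \<le> N" for N
  proof -
    have ex: "4 * N < q (Suc (4 * N))"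
      using seq_suble[OF strict_mono_q, of "Suc (4 * N)"] by simp
    \<comment> \<open>The predecessor \<open>k\<close> of the least such \<open>j\<close> satisfies
      \<open>q k \<le> 4 * N < q (Suc k)\<close>. The factor 4 keeps the argument
      \<open>2 * pi * N / q (Suc k)\<close> below \<open>pi / 2\<close>, within the range of the
      linear lower bound for chords.\<close>
    define j where "j = (LEAST j. 4 * N < q j)"
    have j: "4 * N < q j" unfolding j_def by (rule LeastI, rule ex)
    then have "k0 < j"
      using N strict_mono_less[OF strict_mono_q, of k0 j] by simp
    then obtain k where k: "j = Suc k" "k0 \<le> k" by (cases j) auto
    then have qk: "q k \<le> 4 * N"
      using not_less_Least[of k "\<lambda>j. 4 * N < q j"] unfolding j_def by simp
    let ?R = "real (q (Suc k))" and ?r = "real (q k)"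
    have pos: "0 < ?R" "0 < ?r" "0 < B k" using q_pos B_ge_1[of k] by simp_all
    have R: "4 * real N < ?R" using j k by simp
    have "?r / (4 * ?R) \<le> cmod (lam k ^ N - 1)"
    proof -
      have "?r / (4 * ?R) \<le> 1 * real N / ?R"
        using qk pos by (simp add: field_simps)
      also have "\<dots> \<le> pi * N / ?R"
        using pi_gt3 by (intro divide_right_mono mult_right_mono) simp_all
      also have "\<dots> \<le> cmod (cis (2 * pi * N / ?R) - 1)"
      proof -
        have "pi * (4 * real N) \<le> pi * ?R" using R by (intro mult_left_mono) auto
        moreover have "0 \<le> pi * ?R" by simp
        ultimately have "2 * pi * N / ?R \<le> 2 * pi / 3"
          using pos by (simp add: field_simps)
        then show ?thesis
          using norm_cis_minus_one_ge[of "2 * pi * N / ?R"] by simp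
      qed
      finally show ?thesis unfolding lam_power .
    qed
    moreover have "B k * (?R / ?r) * s / 2 \<le> cmod (h k y)"
    proof -
      have "real k * 1 \<le> 4 ^ Suc k * real (A (Suc k))"
      proof (rule mult_mono)
        have "real k \<le> 2 ^ k" using of_nat_less_two_power[where ?'a = real, of k] by simp
        also have "\<dots> \<le> 4 ^ k" by (intro power_mono) auto
        also have "\<dots> \<le> (4::real) ^ Suc k" by simp
        finally show "real k \<le> 4 ^ Suc k" .
      qed (use A_pos[of "Suc k"] in \<open>simp_all add: Suc_le_eq\<close>)
      also have "\<dots> = ?R / ?r" using pos by (simp add: q.simps)
      finally have "real k0 * s \<le> ?R / ?r * s"
        using s k(2) by (intro mult_right_mono) auto
      then have "2 * norm y \<le> ?R / ?r * s" using k0 by simp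
      then have "2 * (B k * norm y) \<le> B k * (?R / ?r) * s"
        using mult_left_mono[of "2 * norm y" "?R / ?r * s" "B k"] pos by (simp add: mult.assoc mult.left_commute)
      moreover have "B k * (?R / ?r) * s - B k * norm y \<le> cmod (h k y)"
      proof -
        have "cmod (of_real (B k * ?R / ?r) * \<phi> 1 y) = B k * (?R / ?r) * s"
          unfolding norm_mult norm_of_real s_def using pos by simp
        then show ?thesis
          using norm_\<phi>_le[of k y] norm_diff_ineq[of "of_real (B k * ?R / ?r) * \<phi> 1 y" "\<phi> (k + 2) y"]
            assms(3) unfolding h_def by (simp add: add.commute)
      qed
      ultimately show ?thesis
        using half_le[of "B k * norm y" "B k * (?R / ?r) * s"] by blast
    qed
    \<comment> \<open>The quotient \<open>q (Suc k) / q k\<close> cancels, and the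
      \<open>B k\<close> in the weight offsets the norm of \<open>\<phi> (k + 2)\<close>. What
      remains is \<open>s / 8\<close>, independent of \<open>N\<close>.\<close>
    ultimately have "?r / (4 * ?R) * (B k * (?R / ?r) * s / 2) \<le> cmod (lam k ^ N - 1) * cmod (h k y)"
      using pos s by (intro mult_mono) auto
    also have "\<dots> = cmod (\<phi> (k + 2) ((T ^^ N) y - y))"
      unfolding \<phi>_T_power norm_mult ..
    also have "\<dots> \<le> B k * norm ((T ^^ N) y - y)" by (rule norm_\<phi>_le)
    finally have "B k * (s / 8) \<le> B k * norm ((T ^^ N) y - y)"
      using pos by simp
    then show ?thesis using pos by simp
  qed
  have "(\<lambda>n. (T ^^ \<omega> n) y) \<longlonglongrightarrow> y" using y by (simp add: Lset_def)
  then obtain n0 where "\<And>n. n \<ge> n0 \<Longrightarrow> norm ((T ^^ \<omega> n) y - y) < s / 8"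
    using LIMSEQ_D[of "\<lambda>n. (T ^^ \<omega> n) y" y "s / 8"] s by auto
  from this[of "max n0 (q k0)"] lower[of "\<omega> (max n0 (q k0))"] seq_suble[OF \<omega>, of "max n0 (q k0)"]
  show False by auto
qed

text \<open>The combination of \<open>x\<close> and \<open>z\<close> that \<open>\<phi> 0\<close>
  annihilates returns as well, so \<open>\<phi> 1\<close> must annihilate it.\<close>

lemma Lset_\<phi>_proportional:
  assumes \<omega>: "strict_mono \<omega>" and L: "x \<in> Lset T \<omega>" "z \<in> Lset T \<omega>"
  shows "\<phi> 0 x * \<phi> 1 z = \<phi> 1 x * \<phi> 0 z"
proof -
  let ?w = "sc (\<phi> 0 x) z - sc (\<phi> 0 z) x"
  have "?w \<in> Lset T \<omega>"
    using L subspace_Lset by (intro cs.subspace_diff cs.subspace_scale)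
  moreover have "\<phi> 0 ?w = 0"
    by (simp add: dual_diff[OF \<phi>_dual] dual_scale[OF \<phi>_dual])
  ultimately have "\<phi> 1 ?w = 0"
    by (rule Lset_\<phi>_one_eq_zero[OF \<omega>])
  then show ?thesis
    by (simp add: dual_diff[OF \<phi>_dual] dual_scale[OF \<phi>_dual] mult.commute)
qed

lemma closed_\<phi>_proportional: "closed {z. a * \<phi> 1 z = c * \<phi> 0 z}"
  by (intro closed_Collect_eq continuous_on_mult continuous_on_const continuous_on_\<phi>)

text \<open>All returning vectors lie in one closed hyperplane: the one through a returning
  \<open>x\<close> with \<open>\<phi> 0 x \<noteq> 0\<close> if there is one, and otherwise the
  kernel of \<open>\<phi> 0\<close>.\<close>

lemma closure_Lset_neq_UNIV:
  assumes "strict_mono \<omega>" shows "closure (Lset T \<omega>) \<noteq> UNIV"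
proof (cases "\<exists>x\<in>Lset T \<omega>. \<phi> 0 x \<noteq> 0")
  case True
  then obtain x where x: "x \<in> Lset T \<omega>" "\<phi> 0 x \<noteq> 0" by blast
  have "closure (Lset T \<omega>) \<subseteq> {z. \<phi> 0 x * \<phi> 1 z = \<phi> 1 x * \<phi> 0 z}"
    using Lset_\<phi>_proportional[OF assms x(1)] by (intro closure_minimal closed_\<phi>_proportional) auto
  moreover have "\<phi> 0 x * \<phi> 1 (e 1) \<noteq> \<phi> 1 x * \<phi> 0 (e 1)" using x by (simp add: \<phi>_e)
  ultimately show ?thesis by auto
next
  case False
  then have "closure (Lset T \<omega>) \<subseteq> {z. 0 * \<phi> 1 z = 1 * \<phi> 0 z}"
    by (intro closure_minimal closed_\<phi>_proportional) auto
  moreover have "0 * \<phi> 1 (e 0) \<noteq> 1 * \<phi> 0 (e 0)" by (simp add: \<phi>_e)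
  ultimately show ?thesis by auto
qed

section \<open>Return times of finite combinations\<close>

lemma span_e_finite_support:
  assumes "x \<in> cs.span (range e)"
  obtains n where "\<And>k. n \<le> k \<Longrightarrow> \<phi> k x = 0"
proof -
  have "\<exists>n. \<forall>k\<ge>n. \<phi> k x = 0"
    using assms
  proof (induction rule: cs.span_induct_alt)
    case base
    have "\<phi> k 0 = 0" for k using dual_scale[OF \<phi>_dual, of k 0 0] by simp
    then show ?case by simp
  next
    case (step c u v)
    then obtain n m where "u = e m" "\<forall>k\<ge>n. \<phi> k v = 0" by blast
    then have "\<forall>k\<ge>max n (Suc m). \<phi> k (sc c u + v) = 0"
      by (simp add: dual_add[OF \<phi>_dual] dual_scale[OF \<phi>_dual] \<phi>_e)
    then show ?case ..
  qed
  then show ?thesis using that by blast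
qed

text \<open>The powers of a root of unity form a finite, hence discrete, set.\<close>

lemma lam_power_eventually_one:
  assumes "(\<lambda>n. lam k ^ \<omega> n) \<longlonglongrightarrow> 1"
  shows "\<forall>\<^sub>F n in sequentially. lam k ^ \<omega> n = 1"
proof -
  let ?S = "(\<lambda>i. lam k ^ i) ` {..<q (Suc k)}"
  have "open (- (?S - {1}))"
    by (intro open_Compl finite_imp_closed) auto
  from topological_tendstoD[OF assms this]
  have "\<forall>\<^sub>F n in sequentially. lam k ^ \<omega> n \<in> - (?S - {1})"
    by blast
  moreover have "lam k ^ N \<in> ?S" for N
  proof -
    have "lam k ^ N = lam k ^ (q (Suc k) * (N div q (Suc k))) * lam k ^ (N mod q (Suc k))"
      by (simp flip: power_add)
    also have "\<dots> = lam k ^ (N mod q (Suc k))"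
      using lam_power_eq_one by simp
    finally show ?thesis using q_pos[of "Suc k"] by auto
  qed
  ultimately show ?thesis
    by (auto elim: eventually_mono)
qed

text \<open>\<open>lam j\<close> is a power of \<open>lam k\<close>, because
  \<open>q (Suc j)\<close> divides \<open>q (Suc k)\<close>.\<close>

lemma lam_power_eq_one_mono:
  assumes "j \<le> k" "lam k ^ N = 1" shows "lam j ^ N = 1"
proof -
  obtain m where m: "q (Suc k) = q (Suc j) * m"
    using q_dvd[of "Suc j" "Suc k"] assms(1) by auto
  have "lam k ^ m = cis (2 * pi * m / q (Suc k))" by (rule lam_power)
  also have "\<dots> = lam j"
    unfolding lam_def m using q_pos[of "Suc k"] m by simp
  finally show ?thesis
    using assms(2) by (metis mult.commute power_mult power_one)
qed

text \<open>Some \<open>k \<ge> j\<close> beyond the support of \<open>x\<close> has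
  \<open>h k x \<noteq> 0\<close>. Coordinate \<open>k\<close> then forces
  \<open>lam k ^ \<omega> n = 1\<close> eventually, so \<open>lam j ^ \<omega> n = 1\<close> too,
  and \<open>b j\<close> is eventually fixed.\<close>

lemma b_in_Lset:
  assumes x: "x \<in> Lset T \<omega>" "x \<in> cs.span (range e)"
    and inf: "infinite {k. \<phi> 1 x \<noteq> d k * \<phi> 0 x}"
  shows "b j \<in> Lset T \<omega>"
proof -
  obtain n0 where n0: "\<And>k. n0 \<le> k \<Longrightarrow> \<phi> k x = 0"
    using span_e_finite_support[OF x(2)] by blast
  obtain k where k: "max j n0 \<le> k" "\<phi> 1 x \<noteq> d k * \<phi> 0 x"
    using inf unfolding infinite_nat_iff_unbounded_le by blast
  have "of_real (B k * q (Suc k) / q k) \<noteq> (0::complex)"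
    using B_ge_1[of k] q_pos[of k] q_pos[of "Suc k"] by simp
  then have h: "h k x \<noteq> 0"
    using k n0[of "k + 2"] unfolding h_def by simp
  have "(\<lambda>n. (T ^^ \<omega> n) x - x) \<longlonglongrightarrow> 0"
    using x(1) unfolding Lset_def by (simp add: LIM_zero)
  then have "(\<lambda>n. \<phi> (k + 2) ((T ^^ \<omega> n) x - x)) \<longlonglongrightarrow> \<phi> (k + 2) 0"
    by (intro bounded_linear.tendsto[OF dual_bounded_linear] \<phi>_dual)
  then have "(\<lambda>n. (lam k ^ \<omega> n - 1) * h k x / h k x + 1) \<longlonglongrightarrow> 0 / h k x + 1"
    unfolding \<phi>_T_power using h linear_simps(3)[OF dual_bounded_linear[OF \<phi>_dual]]
    by (intro tendsto_add tendsto_divide tendsto_const) auto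
  then have "\<forall>\<^sub>F n in sequentially. lam k ^ \<omega> n = 1"
    using h by (intro lam_power_eventually_one) simp
  then have "\<forall>\<^sub>F n in sequentially. (T ^^ \<omega> n) (b j) = b j"
  proof eventually_elim
    case (elim n)
    then have "lam j ^ \<omega> n = 1" using k(1) by (intro lam_power_eq_one_mono[of j k]) auto
    then have "(lam i ^ \<omega> n - 1) * h i (b j) = 0" for i
      unfolding h_b by simp
    then show ?case unfolding T_power by (simp only: cs.scale_zero_left suminf_zero add_0_right)
  qed
  then show ?thesis unfolding Lset_def by (auto intro: tendsto_eventually)
qed

text \<open>The hyperplane is the line through \<open>x\<close> plus the common kernel of
  \<open>\<phi> 0\<close> and \<open>\<phi> 1\<close>. The vectors \<open>b i\<close> span a dense
  subspace of that kernel, and all of them return.\<close>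

lemma closure_Lset_eq:
  assumes \<omega>: "strict_mono \<omega>" and x: "x \<in> Lset T \<omega>" "x \<in> cs.span (range e)"
    and "\<phi> 0 x \<noteq> 0" and inf: "infinite {k. \<phi> 1 x \<noteq> d k * \<phi> 0 x}"
  shows "closure (Lset T \<omega>) = {z. \<phi> 0 x * \<phi> 1 z = \<phi> 1 x * \<phi> 0 z}"
proof
  show "closure (Lset T \<omega>) \<subseteq> {z. \<phi> 0 x * \<phi> 1 z = \<phi> 1 x * \<phi> 0 z}"
    using Lset_\<phi>_proportional[OF \<omega> x(1)] by (intro closure_minimal closed_\<phi>_proportional) auto
  \<comment> \<open>The projection onto the common kernel along \<open>e 0\<close> and
    \<open>e 1\<close>; it maps each \<open>e m\<close> to 0 or to some \<open>b i\<close>.\<close>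
  define R where "R s = s - sc (\<phi> 0 s) (e 0) - sc (\<phi> 1 s) (e 1)" for s
  have R: "R s \<in> Lset T \<omega>" if "s \<in> cs.span (range e)" for s
    using that
  proof (induction rule: cs.span_induct_alt)
    case base
    have "\<phi> k 0 = 0" for k using dual_scale[OF \<phi>_dual, of k 0 0] by simp
    then show ?case using cs.subspace_0[OF subspace_Lset] by (simp add: R_def)
  next
    case (step c u v)
    then obtain m where u: "u = e m" by blast
    have "R (e m) \<in> Lset T \<omega>"
    proof (cases "m < 2")
      case True
      then have "R (e m) = 0" by (auto simp: R_def \<phi>_e less_2_cases_iff)
      then show ?thesis using cs.subspace_0[OF subspace_Lset] by simp
    next
      case False
      then obtain i where m: "m = i + 2" by (metis le_add_diff_inverse2 not_less)
      then have "R (e m) = b i" by (simp add: R_def \<phi>_e)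
      then show ?thesis using b_in_Lset[OF x inf] by metis
    qed
    moreover have "R (sc c u + v) = sc c (R u) + R v"
      by (simp add: R_def dual_add[OF \<phi>_dual] dual_scale[OF \<phi>_dual] cs.scale_left_distrib
          cs.scale_right_diff_distrib)
    ultimately show ?case
      unfolding u using step subspace_Lset by (auto intro: cs.subspace_add cs.subspace_scale)
  qed
  show "{z. \<phi> 0 x * \<phi> 1 z = \<phi> 1 x * \<phi> 0 z} \<subseteq> closure (Lset T \<omega>)"
  proof
    fix z assume "z \<in> {z. \<phi> 0 x * \<phi> 1 z = \<phi> 1 x * \<phi> 0 z}"
    then have z: "\<phi> 0 x * \<phi> 1 z = \<phi> 1 x * \<phi> 0 z" by simp
    define c where "c = \<phi> 0 z / \<phi> 0 x"
    \<comment> \<open>A continuous map that fixes \<open>z\<close> and sends the dense span of the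
      \<open>e k\<close> into \<open>Lset T \<omega>\<close>; hence \<open>z\<close> lies in the
      closure.\<close>
    define g where "g s = R (s - sc c x) + sc c x" for s
    have "\<phi> 0 (z - sc c x) = 0" "\<phi> 1 (z - sc c x) = 0"
      using z assms(4) by (simp_all add: c_def dual_diff[OF \<phi>_dual] dual_scale[OF \<phi>_dual] field_simps)
    then have gz: "g z = z" by (simp add: g_def R_def)
    have "continuous_on UNIV g"
      unfolding g_def R_def
      by (intro continuous_intros bounded_bilinear.continuous_on[OF bounded_bilinear_sc]
          continuous_on_compose2[OF continuous_on_\<phi>[of UNIV]]) auto
    moreover have "g ` cs.span (range e) \<subseteq> Lset T \<omega>"
    proof safe
      fix s assume "s \<in> cs.span (range e)"
      then have "s - sc c x \<in> cs.span (range e)"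
        using x(2) by (intro cs.span_diff cs.span_scale)
      then show "g s \<in> Lset T \<omega>"
        unfolding g_def using R x(1) subspace_Lset by (intro cs.subspace_add cs.subspace_scale) auto
    qed
    ultimately have "g ` closure (cs.span (range e)) \<subseteq> closure (Lset T \<omega>)"
      using closure_subset
      by (intro image_closure_subset[of _ g]) (auto intro: continuous_on_subset)
    then show "z \<in> closure (Lset T \<omega>)"
      using gz dense by (metis UNIV_I image_subset_iff)
  qed
qed

text \<open>The times are \<open>q K\<close> with \<open>\<phi> 1 x = d K * \<phi> 0 x\<close> and
  \<open>K\<close> beyond the support of \<open>x\<close>. Terms \<open>k < K\<close> vanish because
  \<open>q (Suc k)\<close> divides \<open>q K\<close>, term \<open>K\<close> because
  \<open>h K x = 0\<close>, and \<open>q_growth\<close> controls the tail.\<close>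

lemma mem_Lset_if_on_line:
  assumes x: "x \<in> cs.span (range e)" and inf: "infinite {k. \<phi> 1 x = d k * \<phi> 0 x}"
  obtains \<omega> where "strict_mono \<omega>" "\<And>n. 0 < \<omega> n" "x \<in> Lset T \<omega>"
proof -
  obtain n0 where n0: "\<And>k. n0 \<le> k \<Longrightarrow> \<phi> k x = 0"
    using span_e_finite_support[OF x] by blast
  define S where "S = {k. \<phi> 1 x = d k * \<phi> 0 x} - {..<n0}"
  have S: "infinite S" using inf unfolding S_def by simp
  let ?C = "2 * pi * (M - 1) * norm x"
  have C: "0 \<le> ?C" using M_ge_1 by simp
  have bound: "norm ((T ^^ q K) x - x) \<le> 2 * ?C * (1 / 2) ^ K" if K: "K \<in> S" for K
  proof -
    have summand: "norm (sc ((lam k ^ q K - 1) * h k x) (b k)) \<le> ?C * (1 / 2) ^ K * (1 / 2) ^ k" for k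
    proof (cases k K rule: linorder_cases)
      case less
      then have "lam k ^ q K = 1" by (intro lam_power_eq_one q_dvd) simp
      then show ?thesis using C by simp
    next
      case equal
      then have "h k x = 0" using K n0[of "k + 2"] by (simp add: S_def h_def)
      then show ?thesis using C by simp
    next
      case greater
      let ?R = "real (q (Suc k))" and ?r = "real (q k)"
      have pos: "0 < ?R" "0 < ?r" "0 \<le> B k" using q_pos B_ge_1[of k] by simp_all
      have "\<phi> (k + 2) x = 0" using greater K n0[of "k + 2"] by (simp add: S_def)
      then have "cmod (h k x) = B k * ?R / ?r * cmod (\<phi> 1 x - d k * \<phi> 0 x)"
        unfolding h_def using pos by (simp add: norm_mult norm_divide)
      also have "\<dots> \<le> B k * ?R / ?r * ((1 + cmod (d k)) * ((M - 1) * norm x))"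
        using pos by (intro mult_left_mono norm_\<phi>_diff_le) auto
      also have "\<dots> = B k * (1 + cmod (d k)) * (?R / ?r * ((M - 1) * norm x))"
        by (simp add: mult_ac)
      also have "\<dots> \<le> A k * (?R / ?r * ((M - 1) * norm x))"
        using pos M_ge_1 by (intro mult_right_mono A_ge) auto
      finally have "cmod (lam k ^ q K - 1) * cmod (h k x)
          \<le> q K * (2 * pi / ?R) * (A k * (?R / ?r * ((M - 1) * norm x)))"
        using pos by (intro mult_mono norm_lam_power_minus_one_le) auto
      also have "\<dots> = ?C * (q K * A k / ?r)"
        using pos by (simp add: field_simps)
      also have "\<dots> \<le> ?C * ((1 / 2) ^ K * (1 / 2) ^ k)"
      proof (intro mult_left_mono C)
        have "real (q K * (2 ^ K * 2 ^ k * A k)) \<le> ?r"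
          using q_growth[OF greater] by (simp only: of_nat_le_iff)
        then show "q K * A k / ?r \<le> (1 / 2) ^ K * (1 / 2) ^ k"
          using pos by (simp add: field_simps power_divide)
      qed
      finally show ?thesis by (simp add: norm_sc norm_e norm_mult)
    qed
    have s: "summable (\<lambda>k. ?C * (1 / 2) ^ K * (1 / 2) ^ k)"
      by (intro summable_mult summable_geometric) simp
    have "norm ((T ^^ q K) x - x) \<le> (\<Sum>k. ?C * (1 / 2) ^ K * (1 / 2) ^ k)"
      unfolding T_power add_diff_cancel_left' by (intro norm_suminf_le s summand)
    also have "\<dots> = 2 * ?C * (1 / 2) ^ K"
      using suminf_mult[OF summable_geometric[of "1 / 2 :: real"], of "?C * (1 / 2) ^ K"]
        suminf_geometric[of "1 / 2 :: real"] by simp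
    finally show ?thesis .
  qed
  define \<omega> where "\<omega> = q \<circ> enumerate S"
  have "(\<lambda>n. (T ^^ \<omega> n) x) \<longlonglongrightarrow> x"
  proof (rule LIM_zero_cancel)
    show "(\<lambda>n. (T ^^ \<omega> n) x - x) \<longlonglongrightarrow> 0"
    proof (rule Lim_null_comparison)
      show "\<forall>\<^sub>F n in sequentially. norm ((T ^^ \<omega> n) x - x) \<le> 2 * ?C * (1 / 2) ^ n"
      proof (intro always_eventually allI)
        fix n
        have "norm ((T ^^ \<omega> n) x - x) \<le> 2 * ?C * (1 / 2) ^ enumerate S n"
          using bound[OF enumerate_in_set[OF S, of n]] by (simp only: \<omega>_def o_apply)
        also have "\<dots> \<le> 2 * ?C * (1 / 2) ^ n"
          using C le_enumerate[OF S, of n] by (intro mult_left_mono power_decreasing) auto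
        finally show "norm ((T ^^ \<omega> n) x - x) \<le> 2 * ?C * (1 / 2) ^ n" .
      qed
      show "(\<lambda>n. 2 * ?C * (1 / 2) ^ n) \<longlonglongrightarrow> 0"
        by (intro tendsto_mult_right_zero LIMSEQ_power_zero) simp
    qed
  qed
  then have "x \<in> Lset T \<omega>" by (simp add: Lset_def)
  moreover have "strict_mono \<omega>"
    unfolding \<omega>_def by (intro strict_mono_o strict_mono_q strict_mono_enumerate S)
  ultimately show ?thesis
    using q_pos by (intro that[of \<omega>]) (auto simp: \<omega>_def)
qed

section \<open>The dense set of stationary vectors\<close>

definition Q :: "'a set" where
  "Q = {x \<in> cs.span (range e). \<phi> 0 x \<noteq> 0 \<and> (\<exists>k. \<phi> 1 x = d k * \<phi> 0 x)}"

text \<open>A small multiple of \<open>e 0\<close> makes \<open>\<phi> 0\<close> nonzero, after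
  which a small multiple of \<open>e 1\<close> moves the ratio of \<open>\<phi> 1\<close> to
  \<open>\<phi> 0\<close> onto a value of \<open>d\<close>.\<close>

lemma closure_Q:
  assumes "closure (range d) = UNIV" shows "closure Q = UNIV"
proof -
  have "s \<in> closure Q" if s: "s \<in> cs.span (range e)" for s
    unfolding closure_approachable
  proof (intro allI impI)
    fix \<epsilon> :: real assume \<epsilon>: "0 < \<epsilon>"
    \<comment> \<open>At most one of \<open>\<epsilon> / 2\<close> and \<open>\<epsilon> / 3\<close>
      can make the sum vanish.\<close>
    obtain t :: real where t: "0 < t" "t \<le> \<epsilon> / 2" "\<phi> 0 s + of_real t \<noteq> 0"
    proof (cases "\<phi> 0 s + of_real (\<epsilon> / 2) = 0")
      case True
      then have "\<phi> 0 s + of_real (\<epsilon> / 3) \<noteq> 0"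
        using \<epsilon> by (auto simp: add_eq_0_iff simp flip: of_real_minus)
      then show ?thesis using \<epsilon> by (intro that[of "\<epsilon> / 3"]) auto
    qed (use \<epsilon> that[of "\<epsilon> / 2"] in auto)
    define a where "a = \<phi> 0 s + of_real t"
    have a: "0 < cmod a" using t by (simp add: a_def)
    have "\<phi> 1 s / a \<in> closure (range d)" using assms by simp
    then obtain k where k: "dist (d k) (\<phi> 1 s / a) < \<epsilon> / (2 * cmod a)"
      unfolding closure_approachable using \<epsilon> a
      by (metis divide_pos_pos mult_pos_pos rangeE zero_less_numeral)
    define x where "x = s + sc (of_real t) (e 0) + sc (d k * a - \<phi> 1 s) (e 1)"
    have "x \<in> cs.span (range e)"
      unfolding x_def using s by (intro cs.span_add cs.span_scale) (auto intro: cs.span_base)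
    moreover have "\<phi> 0 x = a" "\<phi> 1 x = d k * a"
      by (simp_all add: x_def a_def dual_add[OF \<phi>_dual] dual_scale[OF \<phi>_dual] \<phi>_e)
    ultimately have "x \<in> Q" using a by (auto simp: Q_def)
    moreover have "dist x s < \<epsilon>"
    proof -
      have "cmod (d k * a - \<phi> 1 s) = cmod a * dist (d k) (\<phi> 1 s / a)"
        using a by (simp add: dist_norm right_diff_distrib flip: norm_mult) (simp add: mult.commute)
      also have "\<dots> < \<epsilon> / 2" using k a by (simp add: field_simps)
      finally have "cmod (d k * a - \<phi> 1 s) < \<epsilon> / 2" .
      moreover have "dist x s \<le> t + cmod (d k * a - \<phi> 1 s)"
        unfolding x_def dist_norm add.assoc add_diff_cancel_left'
        using norm_triangle_ineq[of "sc (of_real t) (e 0)" "sc (d k * a - \<phi> 1 s) (e 1)"] t(1)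
        by (simp add: norm_sc norm_e)
      ultimately show ?thesis using t(2) by simp
    qed
    ultimately show "\<exists>x\<in>Q. dist x s < \<epsilon>" by blast
  qed
  then show ?thesis
    using dense closure_minimal[of "cs.span (range e)" "closure Q"] by auto
qed

context
  assumes d_dense: "closure (range d) = UNIV" and d_repeats: "\<And>k. infinite {j. d j = d k}"
begin

text \<open>The first set supplies return times for \<open>x\<close>, the second lets every return
  time of \<open>x\<close> control all \<open>b j\<close>. Density gives \<open>d\<close> a second
  value, and each value is repeated infinitely often.\<close>

lemma Q_infinite:
  assumes "x \<in> Q"
  shows "infinite {k. \<phi> 1 x = d k * \<phi> 0 x}" "infinite {k. \<phi> 1 x \<noteq> d k * \<phi> 0 x}"
proof -
  obtain k where x: "\<phi> 0 x \<noteq> 0" "\<phi> 1 x = d k * \<phi> 0 x" using assms by (auto simp: Q_def)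
  have "range d \<noteq> {d k}"
  proof
    assume "range d = {d k}"
    then have "closure {d k} = UNIV" using d_dense by metis
    then have "d k + 1 \<in> {d k}" by auto
    then show False by simp
  qed
  then obtain l where "d l \<noteq> d k" by auto
  then have "{j. d j = d l} \<subseteq> {j. \<phi> 1 x \<noteq> d j * \<phi> 0 x}" using x by auto
  then show "infinite {k. \<phi> 1 x \<noteq> d k * \<phi> 0 x}" using d_repeats infinite_super by blast
  have "{j. d j = d k} \<subseteq> {j. \<phi> 1 x = d j * \<phi> 0 x}" using x by auto
  then show "infinite {k. \<phi> 1 x = d k * \<phi> 0 x}" using d_repeats infinite_super by blast
qed

lemma closure_Lset_eq_Q:
  assumes "x \<in> Q" "strict_mono \<omega>" "x \<in> Lset T \<omega>"
  shows "closure (Lset T \<omega>) = {z. \<phi> 0 x * \<phi> 1 z = \<phi> 1 x * \<phi> 0 z}"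
  using closure_Lset_eq[OF assms(2,3) _ _ Q_infinite(2)[OF assms(1)]] assms(1) by (simp add: Q_def)

lemma Q_subset_Rec: "Q \<subseteq> Rec T"
proof
  fix x assume x: "x \<in> Q"
  then have "x \<in> cs.span (range e)" by (simp add: Q_def)
  from mem_Lset_if_on_line[OF this Q_infinite(1)[OF x]] show "x \<in> Rec T"
    unfolding Rec_def by blast
qed

lemma codim_one_hyperplane:
  assumes "a \<noteq> 0" shows "codim_one sc {z. a * \<phi> 1 z = c * \<phi> 0 z}"
  unfolding codim_one_def
proof (intro conjI exI[of _ "e 1"] allI)
  show "cs.subspace {z. a * \<phi> 1 z = c * \<phi> 0 z}"
    using dual_scale[OF \<phi>_dual, of _ 0 0]
    by (intro cs.subspaceI)
       (auto simp: dual_add[OF \<phi>_dual] dual_scale[OF \<phi>_dual] distrib_left mult.left_commute[of a])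
  have "e 1 \<notin> {z. a * \<phi> 1 z = c * \<phi> 0 z}" using assms by (simp add: \<phi>_e)
  then show "{z. a * \<phi> 1 z = c * \<phi> 0 z} \<noteq> UNIV" by blast
  show "\<exists>t. x - sc t (e 1) \<in> {z. a * \<phi> 1 z = c * \<phi> 0 z}" for x
    using assms
    by (intro exI[of _ "\<phi> 1 x - c * \<phi> 0 x / a"])
       (simp add: dual_diff[OF \<phi>_dual] dual_scale[OF \<phi>_dual] \<phi>_e)
qed

lemma recurrent_T: "recurrent T"
  and Hr_T: "Hr T = {}"
  and closure_stationary_codim_one: "closure {x \<in> St T. \<forall>\<omega>\<in>Cseq T. x \<in> Lset T \<omega> \<longrightarrow> codim_one sc (closure (Lset T \<omega>))} = UNIV"
proof -
  show "recurrent T"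
    using closure_mono[OF Q_subset_Rec] closure_Q[OF d_dense] by (auto simp: recurrent_def)
  have "Q \<noteq> {}" using closure_Q[OF d_dense] by auto
  then obtain x where x: "x \<in> Q" by blast
  then have "x \<noteq> 0" using dual_scale[OF \<phi>_dual, of 0 0 0] by (auto simp: Q_def)
  \<comment> \<open>The vector 0 returns along every sequence, so excluding it from
    \<open>Hr T\<close> requires some member of \<open>Cseq T\<close>.\<close>
  then obtain \<omega>0 where \<omega>0: "\<omega>0 \<in> Cseq T"
    using x Q_subset_Rec unfolding Rec_def Cseq_def by blast
  show "Hr T = {}"
  proof (rule equals0I)
    fix y assume y: "y \<in> Hr T"
    obtain \<omega> where "\<omega> \<in> Cseq T" "y \<in> Lset T \<omega>"
    proof (cases "y = 0")
      case True
      then show ?thesis using \<omega>0 that cs.subspace_0[OF subspace_Lset] by blast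
    next
      case False
      then show ?thesis using y that unfolding Hr_def Rec_def Cseq_def by blast
    qed
    then show False
      using y closure_Lset_neq_UNIV[of \<omega>] by (auto simp: Hr_def Cseq_def)
  qed
  have "Q \<subseteq> {x \<in> St T. \<forall>\<omega>\<in>Cseq T. x \<in> Lset T \<omega> \<longrightarrow> codim_one sc (closure (Lset T \<omega>))}"
  proof (intro subsetI CollectI conjI ballI impI)
    fix x assume x: "x \<in> Q"
    show "x \<in> St T"
      unfolding St_def stationary_def
    proof (intro CollectI conjI ballI impI allI)
      show "x \<in> Rec T" using x Q_subset_Rec by blast
      fix \<omega> r assume "\<omega> \<in> Cseq T" "x \<in> Lset T \<omega>" "strict_mono (r :: nat \<Rightarrow> nat)"
      \<comment> \<open>The formula for the closure depends on \<open>x\<close> alone, so it is the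
        same along a subsequence.\<close>
      then show "closure (Lset T \<omega>) = closure (Lset T (\<omega> \<circ> r))"
        using closure_Lset_eq_Q[OF x] Lset_subsequence
        by (simp add: Cseq_def strict_mono_o)
    qed
    show "codim_one sc (closure (Lset T \<omega>))" if "\<omega> \<in> Cseq T" "x \<in> Lset T \<omega>" for \<omega>
      using that x closure_Lset_eq_Q[OF x] codim_one_hyperplane
      by (simp add: Cseq_def Q_def)
  qed
  from closure_mono[OF this]
  show "closure {x \<in> St T. \<forall>\<omega>\<in>Cseq T. x \<in> Lset T \<omega> \<longrightarrow> codim_one sc (closure (Lset T \<omega>))} = UNIV"
    using closure_Q[OF d_dense] by auto
qed

end

end

section \<open>The sequence of slopes and the conclusion\<close>

lemma exists_dense_repeating_sequence:
  obtains d :: "nat \<Rightarrow> complex" where "closure (range d) = UNIV" "\<And>k. infinite {j. d j = d k}"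
proof -
  obtain D :: "complex set" where D: "countable D" "\<And>X. open X \<Longrightarrow> X \<noteq> {} \<Longrightarrow> \<exists>z\<in>D. z \<in> X"
    using countable_dense_exists by blast
  have "D \<noteq> {}" using D(2)[of UNIV] by auto
  \<comment> \<open>Ignoring the second component of the decoded pair repeats every value infinitely
    often.\<close>
  define d where "d k = from_nat_into D (fst (prod_decode k))" for k
  have d: "d (prod_encode (i, j)) = from_nat_into D i" for i j by (simp add: d_def)
  have "range d = D"
  proof -
    have "range (from_nat_into D) \<subseteq> range d" using d by (metis image_subsetI rangeI)
    moreover have "range d \<subseteq> range (from_nat_into D)" by (auto simp: d_def)
    ultimately show ?thesis using range_from_nat_into[OF \<open>D \<noteq> {}\<close> D(1)] by simp
  qed
  moreover have "closure D = UNIV"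
  proof (rule ccontr)
    assume "closure D \<noteq> UNIV"
    then show False using D(2)[of "- closure D"] closure_subset[of D] by auto
  qed
  moreover have "infinite {j. d j = d k}" for k
  proof -
    obtain i j where "prod_decode k = (i, j)" by fastforce
    then have "range (\<lambda>j. prod_encode (i, j)) \<subseteq> {j. d j = d k}" by (auto simp: d_def)
    moreover have "infinite (range (\<lambda>j. prod_encode (i, j)))"
      by (intro range_inj_infinite injI) (simp add: prod_encode_eq)
    ultimately show ?thesis using infinite_super by blast
  qed
  ultimately show ?thesis by (intro that[of d]) simp_all
qed

theorem theorem4p12:
  fixes sc :: "complex \<Rightarrow> 'a::banach \<Rightarrow> 'a"
  assumes "complex_banach_scale sc"
    and "separable_space (euclidean :: 'a topology)"
    and "infinite_dim_complex sc"
  shows "\<exists>T. bounded_complex_operator sc T \<and> recurrent T \<and> Hr T = {} \<and>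
           closure {q \<in> St T. \<forall>\<omega>\<in>Cseq T. q \<in> Lset T \<omega> \<longrightarrow> codim_one sc (closure (Lset T \<omega>))}
             = UNIV"
proof -
  interpret complex_banach sc by (rule complex_banach.intro, fact)
  show ?thesis
  proof (rule exists_biorthogonal_system[OF assms(2,3)], rule exists_dense_repeating_sequence)
    fix e :: "nat \<Rightarrow> 'a" and \<phi> :: "nat \<Rightarrow> 'a \<Rightarrow> complex" and d :: "nat \<Rightarrow> complex"
    assume e: "\<And>k. norm (e k) = 1" "\<And>k. \<phi> k \<in> dual"
      "\<And>i j. \<phi> i (e j) = (if i = j then 1 else 0)" "closure (cs.span (range e)) = UNIV"
      and d: "closure (range d) = UNIV" "\<And>k. infinite {j. d j = d k}"
    interpret biorthogonal_system sc e \<phi> d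
      by unfold_locales (fact e)+
    show ?thesis
      using T_bounded_complex_operator recurrent_T[OF d] Hr_T[OF d]
        closure_stationary_codim_one[OF d] by blast
  qed
qed

end
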